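(* Let $(T^1,F_1)$ and $(T^2,F_2)$ be rooted trees with sinks over $(Q,\rho)$, and let $M_j:=M(T^j,F_j)$ for $j=1,2$ be the corresponding rooted tree modules. Then the pair $(M_1,M_2)$ is ghost-free.
   Context: Fix a field $\mathcal K$ with $\mathrm{char}(\mathcal K)\neq 2$. Let $Q=(Q_0,Q_1,\varsigma,\varepsilon)$ be a quiver and $\rho$ a set of paths in $Q$ of length at least $2$ that bounds the length of the paths, not lying in the ideal $\langle\rho\rangle$, passing through any vertex. Put $\Lambda:=\mathcal KQ/\langle\rho\rangle$. Finite-dimensional $\Lambda$-modules are identified with finite-dimensional $\mathcal K$-representations of $(Q,\rho)$. A tree is a finite quiver $T=(T_0,T_1,s,t)$ whose underlying undirected graph is connected without cycles. Here rooted trees have a unique sink $\ast$ (the root). For a non-root vertex $n$ there is a unique arrow with source $n$, denoted $a_n$ in $T^1$ and $b_n$ in $T^2$; its target is the parent $\mathsf p(n)$. A quiver morphism is a pair of maps (on vertices and on arrows) commuting with sources and targets. A quiver morphism $F:T\to Q$ is bound, written $F:T\to(Q,\rho)$, if there is no path $p$ in $T$ with $F(p)\in\langle\rho\rangle$; then $(T,F)$ is a tree over $(Q,\rho)$. The rooted tree module $M(T,F)$ has a $\mathcal K$-basis indexed by $T_0$, the basis vector $v_n$ lying at the vertex $F(n)$, and $\gamma\in Q_1$ acts by $\gamma\cdot v_n=\sum_{a\in T_1,\ s(a)=n,\ F(a)=\gamma}v_{t(a)}$. Write $\{v_n\}_{n\in T^1_0}$ and $\{w_m\}_{m\in T^2_0}$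 for these bases of $M_1$ and $M_2$. Networks. A network consists of a quiver together with a set of undirected edges forming a simple graph on the same vertex set. The pullback network $\mathcal N[1]$ has vertices $\mathcal N[1]_0=\{(n,m)\in T^1_0\times T^2_0\mid F_1(n)=F_2(m)\}$; arrows $\mathcal N[1]_1$: $(a_n,b_m):(n,m)\to(\mathsf p(n),\mathsf p(m))$ whenever $F_1(a_n)=F_2(b_m)$; edges $\mathcal E^1=\{\{(n,m),(n,m')\}\mid m\ne m',\ \mathsf p(m)=\mathsf p(m'),\ F_2(b_m)=F_2(b_{m'})\}$. The 2-covering network $\mathcal N[2]$ has $\mathcal N[2]_l=\mathcal N[1]_l\times\{-1,1\}$ for $l=0,1$ (sources and targets keep the sign) and edges $\mathcal E^2=\{\{(n,m,i),(n,m',-i)\}\mid\{(n,m),(n,m')\}\in\mathcal E^1,\ i\in\{-1,1\}\}$; $\pi:\mathcal N[2]\to\mathcal N[1]$ forgets the sign. A link is an arrow, a formal inverse of an arrow, or an edge. A traversal is a walk along links containing no $\alpha\alpha^{-1}$ as a subwalk (with $(\alpha^{-1})^{-1}=\alpha$ for an arrow and $\alpha^{-1}=\alpha$ for an edge); vertices are traversals of length $0$. A triangle in $\mathcal N[1]$ is an induced subnetwork on three vertices whose total number of arrows and edges is $3$. $\mathcal R[1]$ is the set of length-two traversals in $\mathcal N[1]$ through three vertices inducing a triangle, and $\mathcal R[2]$ is the set of traversals $\mathfrak t$ in $\mathcal N[2]$ with $\pi(\mathfrak t)\in\mathcal R[1]$. A subnetwork $\mathcal M=(\mathcal M_0,\mathcal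 M_1,\mathcal E_{\mathcal M})$ of $\mathcal N[2]$ is: $\mathcal R[2]$-free if no traversal in $\mathcal M$ lies in $\mathcal R[2]$; connected if there is a traversal in $\mathcal M$ between any two of its vertices; complete if for each $(n,m,j)\in\mathcal M_0$: (i) for every arrow $a_{n'}:n'\to n$ in $T^1$ there is an arrow $b_{m'}:m'\to m$ in $T^2$ such that the arrow $(a_{n'},b_{m'},j):(n',m',j)\to(n,m,j)$ is in $\mathcal M_1$; (ii) if there is an arrow $b_m:m\to m'$ in $T^2$, then at least one of the following holds: there is an arrow $a_n:n\to n'$ in $T^1$ with $(a_n,b_m,j)\in\mathcal M_1$; or there is $b_{m''}:m''\to m'$ in $T^2$ with $F_2(b_m)=F_2(b_{m''})$, $(n,m'',-j)\in\mathcal M_0$ and $\{(n,m,j),(n,m'',-j)\}\in\mathcal E_{\mathcal M}$. The linear map associated with a subnetwork $\mathcal M$ is $\mathcal H_{\mathcal M}:M_1\to M_2$, $\mathcal H_{\mathcal M}(v_n)=\sum_{(n,m,j)\in\mathcal M_0}j\,w_m$. A ghost is a non-empty, connected, complete and $\mathcal R[2]$-free subnetwork $\mathcal M$ of $\mathcal N[2]$ with $\mathcal H_{\mathcal M}=0$. The pair $(M_1,M_2)$ is ghost-free if $\mathcal N[2]$ does not include a ghost. *)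

theory Defs
  imports Complex_Main "Graph_Theory.Digraph_Component"
begin

text \<open>
  Quivers are the multi-digraphs of the AFP entry Graph_Theory: \<^term>\<open>tail\<close> and \<^term>\<open>head\<close>
  are the source and target maps, and a quiver is well-formed if it satisfies \<^locale>\<open>wf_digraph\<close>.
\<close>

section \<open>Path algebras\<close>

text \<open>
  A path is a starting vertex together with the list of its arrows in the order of traversal;
  \<open>(x, [])\<close> is the trivial path at \<open>x\<close>.
\<close>

type_synonym ('v, 'a) path = "'v \<times> 'a list"

definition paths :: "('v, 'a) pre_digraph \<Rightarrow> ('v, 'a) path set" where
  "paths Q = {(u, p). \<exists>v. pre_digraph.awalk Q u p v}"

definition path_algebra :: "('v, 'a) pre_digraph \<Rightarrow> (('v, 'a) path \<Rightarrow> 'k::field) set" where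
  "path_algebra Q = {f. finite {p. f p \<noteq> 0} \<and> {p. f p \<noteq> 0} \<subseteq> paths Q}"

text \<open>The basis vector indexed by \<open>p\<close>, in a space of coordinate functions.\<close>

definition unit_vec :: "'b \<Rightarrow> 'b \<Rightarrow> 'k::field" where
  "unit_vec p = (\<lambda>q. if q = p then 1 else 0)"

text \<open>
  Bilinear extension of concatenation. Arrows act from the left, so a product of paths traverses
  the right factor first; see \<open>path_mult_unit_vec\<close> below.
\<close>

definition path_mult ::
  "('v, 'a) pre_digraph \<Rightarrow> (('v, 'a) path \<Rightarrow> 'k::field) \<Rightarrow> (('v, 'a) path \<Rightarrow> 'k) \<Rightarrow> ('v, 'a) path \<Rightarrow> 'k"
  where
  "path_mult Q f g = (\<lambda>(u, p). \<Sum>i\<le>length p.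
     f (pre_digraph.awlast Q u (take i p), drop i p) * g (u, take i p))"

definition two_sided_ideal :: "('v, 'a) pre_digraph \<Rightarrow> (('v, 'a) path \<Rightarrow> 'k::field) set \<Rightarrow> bool" where
  "two_sided_ideal Q I \<longleftrightarrow>
     I \<subseteq> path_algebra Q \<and>
     (\<lambda>_. 0) \<in> I \<and>
     (\<forall>f\<in>I. \<forall>g\<in>I. (\<lambda>p. f p + g p) \<in> I) \<and>
     (\<forall>c. \<forall>f\<in>I. (\<lambda>p. c * f p) \<in> I) \<and>
     (\<forall>f\<in>path_algebra Q. \<forall>g\<in>I. path_mult Q f g \<in> I \<and> path_mult Q g f \<in> I)"

definition generated_ideal :: "('v, 'a) pre_digraph \<Rightarrow> ('v, 'a) path set \<Rightarrow> (('v, 'a) path \<Rightarrow> 'k::field) set"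
  where
  "generated_ideal Q rho = \<Inter>{I. two_sided_ideal Q I \<and> unit_vec ` rho \<subseteq> I}"

definition path_in_ideal ::
  "'k::field itself \<Rightarrow> ('v, 'a) pre_digraph \<Rightarrow> ('v, 'a) path set \<Rightarrow> ('v, 'a) path \<Rightarrow> bool" where
  "path_in_ideal _ Q rho p \<longleftrightarrow> (unit_vec p :: ('v, 'a) path \<Rightarrow> 'k) \<in> generated_ideal Q rho"

text \<open>
  The bound on the lengths of the paths outside the ideal may depend on the vertex, and \<open>Q\<close> may be
  infinite.
\<close>

definition bound_quiver :: "'k::field itself \<Rightarrow> ('v, 'a) pre_digraph \<Rightarrow> ('v, 'a) path set \<Rightarrow> bool" where
  "bound_quiver K Q rho \<longleftrightarrow>
     wf_digraph Q \<and>
     rho \<subseteq> paths Q \<and>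
     (\<forall>(u, p)\<in>rho. 2 \<le> length p) \<and>
     (\<forall>x\<in>verts Q. \<exists>N. \<forall>(u, p)\<in>paths Q.
        x \<in> set (pre_digraph.awalk_verts Q u p) \<and> \<not> path_in_ideal K Q rho (u, p) \<longrightarrow> length p \<le> N)"

section \<open>Rooted trees and their modules\<close>

text \<open>
  The underlying undirected multigraph: \<open>(a, True)\<close> and \<open>(a, False)\<close> are the arrow \<open>a\<close> traversed
  forwards and backwards. The constant \<^const>\<open>Digraph_Component.tree\<close> is unsuitable here, as it
  only excludes directed cycles.
\<close>

definition underlying :: "('v, 'e) pre_digraph \<Rightarrow> ('v, 'e \<times> bool) pre_digraph" where
  "underlying T = \<lparr> verts = verts T, arcs = arcs T \<times> UNIV,
     tail = (\<lambda>(a, d). if d then tail T a else head T a),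
     head = (\<lambda>(a, d). if d then head T a else tail T a) \<rparr>"

definition undirected_cycle :: "('v, 'e) pre_digraph \<Rightarrow> ('e \<times> bool) list \<Rightarrow> bool" where
  "undirected_cycle T p \<longleftrightarrow> pre_digraph.cycle (underlying T) p \<and> distinct (map fst p)"

definition tree_quiver :: "('v, 'e) pre_digraph \<Rightarrow> bool" where
  "tree_quiver T \<longleftrightarrow> fin_digraph T \<and> strongly_connected (underlying T) \<and> (\<nexists>p. undirected_cycle T p)"

definition rooted_tree :: "('v, 'e) pre_digraph \<Rightarrow> bool" where
  "rooted_tree T \<longleftrightarrow> tree_quiver T \<and> (\<exists>!r. r \<in> verts T \<and> out_arcs T r = {})"

record ('v, 'e, 'w, 'a) quiver_map =
  vmap :: "'v \<Rightarrow> 'w"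
  amap :: "'e \<Rightarrow> 'a"

definition quiver_morphism ::
  "('v, 'e) pre_digraph \<Rightarrow> ('w, 'a) pre_digraph \<Rightarrow> ('v, 'e, 'w, 'a) quiver_map \<Rightarrow> bool" where
  "quiver_morphism T Q F \<longleftrightarrow>
     vmap F ` verts T \<subseteq> verts Q \<and> amap F ` arcs T \<subseteq> arcs Q \<and>
     (\<forall>a\<in>arcs T. tail Q (amap F a) = vmap F (tail T a) \<and> head Q (amap F a) = vmap F (head T a))"

definition rooted_tree_over ::
  "'k::field itself \<Rightarrow> ('w, 'a) pre_digraph \<Rightarrow> ('w, 'a) path set \<Rightarrow>
   ('v, 'e) pre_digraph \<Rightarrow> ('v, 'e, 'w, 'a) quiver_map \<Rightarrow> bool" where
  "rooted_tree_over K Q rho T F \<longleftrightarrow>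
     rooted_tree T \<and> quiver_morphism T Q F \<and>
     (\<forall>(u, p)\<in>paths T. \<not> path_in_ideal K Q rho (vmap F u, map (amap F) p))"

text \<open>
  A rooted tree module is a module over \<open>\<K>Q/\<langle>\<rho>\<rangle>\<close>, given by the actions of the trivial paths and of
  the arrows of \<open>Q\<close>, that remembers the tree \<open>(T, F)\<close> it comes from: the network of a pair of such
  modules, and hence ghost-freeness, refers to the trees. Module elements are coordinate functions
  with respect to the tree basis, with pointwise vector space structure; the basis vector
  indexed by \<open>n\<close> is \<^term>\<open>unit_vec n\<close>.
\<close>

record ('v, 'e, 'w, 'a, 'k) rooted_tree_module =
  base_tree :: "('v, 'e) pre_digraph"
  base_map :: "('v, 'e, 'w, 'a) quiver_map"
  mcarrier :: "('v \<Rightarrow> 'k) set"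
  vertex_action :: "'w \<Rightarrow> ('v \<Rightarrow> 'k) \<Rightarrow> 'v \<Rightarrow> 'k"
  arrow_action :: "'a \<Rightarrow> ('v \<Rightarrow> 'k) \<Rightarrow> 'v \<Rightarrow> 'k"

definition tree_module ::
  "('v, 'e) pre_digraph \<Rightarrow> ('v, 'e, 'w, 'a) quiver_map \<Rightarrow> ('v, 'e, 'w, 'a, 'k::field) rooted_tree_module"
  where
  "tree_module T F = \<lparr>
     base_tree = T,
     base_map = F,
     mcarrier = {f. \<forall>n. n \<notin> verts T \<longrightarrow> f n = 0},
     vertex_action = (\<lambda>x f k. \<Sum>n\<in>{n \<in> verts T. vmap F n = x}. f n * unit_vec n k),
     arrow_action = (\<lambda>g f k. \<Sum>n\<in>verts T. f n *
       (\<Sum>a\<in>{a \<in> arcs T. tail T a = n \<and> amap F a = g}. unit_vec (head T a) k)) \<rparr>"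

section \<open>Networks\<close>

record ('v, 'a) network =
  quiver :: "('v, 'a) pre_digraph"
  edges :: "'v set set"

definition wf_network :: "('v, 'a) network \<Rightarrow> bool" where
  "wf_network N \<longleftrightarrow> wf_digraph (quiver N) \<and> (\<forall>e\<in>edges N. e \<subseteq> verts (quiver N) \<and> card e = 2)"

definition subnetwork :: "('v, 'a) network \<Rightarrow> ('v, 'a) network \<Rightarrow> bool" where
  "subnetwork M N \<longleftrightarrow> wf_network M \<and> wf_network N \<and>
     subgraph (quiver M) (quiver N) \<and> edges M \<subseteq> edges N"

datatype ('v, 'a) link = Arrow 'a | Formal_Inverse 'a | Edge "'v set"

fun link_inverse :: "('v, 'a) link \<Rightarrow> ('v, 'a) link" where
  "link_inverse (Arrow a) = Formal_Inverse a"
| "link_inverse (Formal_Inverse a) = Arrow a"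
| "link_inverse (Edge e) = Edge e"

fun link_joins :: "('v, 'a) network \<Rightarrow> ('v, 'a) link \<Rightarrow> 'v \<Rightarrow> 'v \<Rightarrow> bool" where
  "link_joins N (Arrow a) u v \<longleftrightarrow>
     a \<in> arcs (quiver N) \<and> tail (quiver N) a = u \<and> head (quiver N) a = v"
| "link_joins N (Formal_Inverse a) u v \<longleftrightarrow>
     a \<in> arcs (quiver N) \<and> head (quiver N) a = u \<and> tail (quiver N) a = v"
| "link_joins N (Edge e) u v \<longleftrightarrow> e \<in> edges N \<and> e = {u, v}"

fun link_walk :: "('v, 'a) network \<Rightarrow> 'v \<Rightarrow> ('v, 'a) link list \<Rightarrow> 'v \<Rightarrow> bool" where
  "link_walk N u [] v \<longleftrightarrow> u \<in> verts (quiver N) \<and> u = v"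
| "link_walk N u (l # ls) v \<longleftrightarrow> (\<exists>w. link_joins N l u w \<and> link_walk N w ls v)"

text \<open>As for paths, a traversal is recorded as its starting vertex and the list of its links.\<close>

definition traversal :: "('v, 'a) network \<Rightarrow> 'v \<Rightarrow> ('v, 'a) link list \<Rightarrow> 'v \<Rightarrow> bool" where
  "traversal N u ls v \<longleftrightarrow> link_walk N u ls v \<and>
     (\<forall>i. Suc i < length ls \<longrightarrow> ls ! Suc i \<noteq> link_inverse (ls ! i))"

definition traversals :: "('v, 'a) network \<Rightarrow> ('v \<times> ('v, 'a) link list) set" where
  "traversals N = {(u, ls). \<exists>v. traversal N u ls v}"

definition connected_network :: "('v, 'a) network \<Rightarrow> bool" where
  "connected_network N \<longleftrightarrow>
     (\<forall>u\<in>verts (quiver N). \<forall>v\<in>verts (quiver N). \<exists>ls. traversal N u ls v)"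

definition induced_subnetwork :: "('v, 'a) network \<Rightarrow> 'v set \<Rightarrow> ('v, 'a) network" where
  "induced_subnetwork N S = \<lparr>
     quiver = (quiver N) \<lparr> verts := S,
       arcs := {a \<in> arcs (quiver N). tail (quiver N) a \<in> S \<and> head (quiver N) a \<in> S} \<rparr>,
     edges = {e \<in> edges N. e \<subseteq> S} \<rparr>"

definition induces_triangle :: "('v, 'a) network \<Rightarrow> 'v set \<Rightarrow> bool" where
  "induces_triangle N S \<longleftrightarrow> S \<subseteq> verts (quiver N) \<and> card S = 3 \<and>
     card (arcs (quiver (induced_subnetwork N S))) + card (edges (induced_subnetwork N S)) = 3"

definition triangle_traversals :: "('v, 'a) network \<Rightarrow> ('v \<times> ('v, 'a) link list) set" where
  "triangle_traversals N = {(u, [l, l']) | u l l'. (u, [l, l']) \<in> traversals N \<and>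
     (\<exists>v w. link_joins N l u v \<and> link_joins N l' v w \<and> induces_triangle N {u, v, w})}"

section \<open>The pullback network and its 2-covering\<close>

definition pullback_network ::
  "('v1, 'e1) pre_digraph \<Rightarrow> ('v1, 'e1, 'w, 'a) quiver_map \<Rightarrow>
   ('v2, 'e2) pre_digraph \<Rightarrow> ('v2, 'e2, 'w, 'a) quiver_map \<Rightarrow> ('v1 \<times> 'v2, 'e1 \<times> 'e2) network" where
  "pullback_network T1 F1 T2 F2 = \<lparr>
     quiver = \<lparr>
       verts = {(n, m). n \<in> verts T1 \<and> m \<in> verts T2 \<and> vmap F1 n = vmap F2 m},
       arcs = {(a, b). a \<in> arcs T1 \<and> b \<in> arcs T2 \<and> amap F1 a = amap F2 b},
       tail = (\<lambda>(a, b). (tail T1 a, tail T2 b)),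
       head = (\<lambda>(a, b). (head T1 a, head T2 b)) \<rparr>,
     edges = {{(n, tail T2 b), (n, tail T2 b')} | n b b'.
       n \<in> verts T1 \<and> b \<in> arcs T2 \<and> b' \<in> arcs T2 \<and>
       vmap F1 n = vmap F2 (tail T2 b) \<and> vmap F1 n = vmap F2 (tail T2 b') \<and>
       tail T2 b \<noteq> tail T2 b' \<and> head T2 b = head T2 b' \<and> amap F2 b = amap F2 b'} \<rparr>"

definition covering_network ::
  "('v1, 'e1) pre_digraph \<Rightarrow> ('v1, 'e1, 'w, 'a) quiver_map \<Rightarrow>
   ('v2, 'e2) pre_digraph \<Rightarrow> ('v2, 'e2, 'w, 'a) quiver_map \<Rightarrow>
   ('v1 \<times> 'v2 \<times> int, 'e1 \<times> 'e2 \<times> int) network" where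
  "covering_network T1 F1 T2 F2 = (let N = pullback_network T1 F1 T2 F2 in \<lparr>
     quiver = \<lparr>
       verts = {(n, m, i). (n, m) \<in> verts (quiver N) \<and> i \<in> {-1, 1}},
       arcs = {(a, b, i). (a, b) \<in> arcs (quiver N) \<and> i \<in> {-1, 1}},
       tail = (\<lambda>(a, b, i). (tail T1 a, tail T2 b, i)),
       head = (\<lambda>(a, b, i). (head T1 a, head T2 b, i)) \<rparr>,
     edges = {{(n, m, i), (n, m', - i)} | n m m' i.
       {(n, m), (n, m')} \<in> edges N \<and> i \<in> {-1, 1}} \<rparr>)"

definition forget_sign :: "'b \<times> 'c \<times> int \<Rightarrow> 'b \<times> 'c" where
  "forget_sign = (\<lambda>(n, m, i). (n, m))"

fun forget_sign_link :: "('b \<times> 'c \<times> int, 'd \<times> 'e \<times> int) link \<Rightarrow> ('b \<times> 'c, 'd \<times> 'e) link" where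
  "forget_sign_link (Arrow a) = Arrow (forget_sign a)"
| "forget_sign_link (Formal_Inverse a) = Formal_Inverse (forget_sign a)"
| "forget_sign_link (Edge e) = Edge (forget_sign ` e)"

definition covering_triangle_traversals ::
  "('v1, 'e1) pre_digraph \<Rightarrow> ('v1, 'e1, 'w, 'a) quiver_map \<Rightarrow>
   ('v2, 'e2) pre_digraph \<Rightarrow> ('v2, 'e2, 'w, 'a) quiver_map \<Rightarrow>
   (('v1 \<times> 'v2 \<times> int) \<times> ('v1 \<times> 'v2 \<times> int, 'e1 \<times> 'e2 \<times> int) link list) set" where
  "covering_triangle_traversals T1 F1 T2 F2 =
     {(u, ls) \<in> traversals (covering_network T1 F1 T2 F2).
        (forget_sign u, map forget_sign_link ls)
          \<in> triangle_traversals (pullback_network T1 F1 T2 F2)}"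

section \<open>Ghosts\<close>

definition complete_subnetwork ::
  "('v1, 'e1) pre_digraph \<Rightarrow> ('v2, 'e2) pre_digraph \<Rightarrow> ('v2, 'e2, 'w, 'a) quiver_map \<Rightarrow>
   ('v1 \<times> 'v2 \<times> int, 'e1 \<times> 'e2 \<times> int) network \<Rightarrow> bool" where
  "complete_subnetwork T1 T2 F2 M \<longleftrightarrow> (\<forall>(n, m, j)\<in>verts (quiver M).
     (\<forall>a\<in>arcs T1. head T1 a = n \<longrightarrow>
        (\<exists>b\<in>arcs T2. head T2 b = m \<and> (a, b, j) \<in> arcs (quiver M))) \<and>
     (\<forall>b\<in>arcs T2. tail T2 b = m \<longrightarrow>
        (\<exists>a\<in>arcs T1. tail T1 a = n \<and> (a, b, j) \<in> arcs (quiver M)) \<or>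
        (\<exists>b''\<in>arcs T2. head T2 b'' = head T2 b \<and> amap F2 b = amap F2 b'' \<and>
           (n, tail T2 b'', - j) \<in> verts (quiver M) \<and>
           {(n, m, j), (n, tail T2 b'', - j)} \<in> edges M)))"

text \<open>
  The linear map associated with a subnetwork, i.e. the linear extension of
  \<open>v\<^sub>n \<mapsto> \<Sum>(n, m, j)\<in>M\<^sub>0. j w\<^sub>m\<close>.
\<close>

definition subnetwork_map ::
  "('v1, 'e1, 'w, 'a, 'k::field) rooted_tree_module \<Rightarrow> ('v1 \<times> 'v2 \<times> int, 'e1 \<times> 'e2 \<times> int) network \<Rightarrow>
   ('v1 \<Rightarrow> 'k) \<Rightarrow> 'v2 \<Rightarrow> 'k" where
  "subnetwork_map M1 M f = (\<lambda>k. \<Sum>n\<in>verts (base_tree M1). f n *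
     (\<Sum>(m, j)\<in>{(m, j). (n, m, j) \<in> verts (quiver M)}. of_int j * unit_vec m k))"

definition ghost ::
  "('v1, 'e1, 'w, 'a, 'k::field) rooted_tree_module \<Rightarrow> ('v2, 'e2, 'w, 'a, 'k) rooted_tree_module \<Rightarrow>
   ('v1 \<times> 'v2 \<times> int, 'e1 \<times> 'e2 \<times> int) network \<Rightarrow> bool" where
  "ghost M1 M2 M \<longleftrightarrow>
     (let T1 = base_tree M1; F1 = base_map M1; T2 = base_tree M2; F2 = base_map M2 in
        subnetwork M (covering_network T1 F1 T2 F2) \<and>
        verts (quiver M) \<noteq> {} \<and>
        connected_network M \<and>
        complete_subnetwork T1 T2 F2 M \<and>
        traversals M \<inter> covering_triangle_traversals T1 F1 T2 F2 = {} \<and>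
        (\<forall>f\<in>mcarrier M1. subnetwork_map M1 M f = (\<lambda>_. 0)))"

definition ghost_free ::
  "('v1, 'e1, 'w, 'a, 'k::field) rooted_tree_module \<Rightarrow> ('v2, 'e2, 'w, 'a, 'k) rooted_tree_module \<Rightarrow> bool"
  where
  "ghost_free M1 M2 \<longleftrightarrow> (\<nexists>M. ghost M1 M2 M)"

section \<open>Consistency of the definitions\<close>

lemma path_mult_unit_vec:
  "path_mult Q (unit_vec (v, q)) (unit_vec (u, p)) =
     (if v = pre_digraph.awlast Q u p then unit_vec (u, p @ q) else (\<lambda>_. 0 :: 'k::field))"
proof (rule ext)
  fix w :: "'a \<times> 'b list"
  obtain x r where w: "w = (x, r)" by (cases w)
  have "path_mult Q (unit_vec (v, q)) (unit_vec (u, p)) w =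
      (\<Sum>i\<le>length r. if i = length p \<and> pre_digraph.awlast Q u p = v \<and> x = u \<and> r = p @ q
                     then 1 else (0 :: 'k))"
    unfolding path_mult_def w case_prod_conv
  proof (rule sum.cong[OF refl])
    fix i assume "i \<in> {..length r}"
    then have "take i r = p \<longleftrightarrow> i = length p \<and> take (length p) r = p" by auto
    moreover have "take (length p) r = p \<and> drop (length p) r = q \<longleftrightarrow> r = p @ q"
      by (metis append_eq_conv_conj)
    ultimately show "unit_vec (v, q) (pre_digraph.awlast Q x (take i r), drop i r) *
        unit_vec (u, p) (x, take i r) =
        (if i = length p \<and> pre_digraph.awlast Q u p = v \<and> x = u \<and> r = p @ q then 1 else (0 :: 'k))"
      by (auto simp: unit_vec_def)
  qed
  also have "\<dots> = (if v = pre_digraph.awlast Q u p then unit_vec (u, p @ q) w else 0)"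
  proof (cases "pre_digraph.awlast Q u p = v \<and> x = u \<and> r = p @ q")
    case True
    then show ?thesis by (simp add: w unit_vec_def)
  qed (auto simp: w unit_vec_def)
  finally show "path_mult Q (unit_vec (v, q)) (unit_vec (u, p)) w =
      (if v = pre_digraph.awlast Q u p then unit_vec (u, p @ q) else (\<lambda>_. 0 :: 'k)) w"
    by (simp only: if_distribR)
qed

lemma two_sided_ideal_path_algebra:
  assumes "wf_digraph Q"
  shows "two_sided_ideal Q (path_algebra Q :: (('v, 'a) path \<Rightarrow> 'k::field) set)"
proof -
  interpret Q: wf_digraph Q by fact
  have mult: "path_mult Q f g \<in> path_algebra Q"
    if f: "f \<in> path_algebra Q" and g: "g \<in> path_algebra Q" for f g :: "('v, 'a) path \<Rightarrow> 'k"
  proof -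
    let ?A = "{p. f p \<noteq> 0}" and ?B = "{p. g p \<noteq> 0}"
    have supp: "\<exists>q p. w = (fst p, snd p @ snd q) \<and> q \<in> ?A \<and> p \<in> ?B \<and>
        fst q = Q.awlast (fst p) (snd p)" if "path_mult Q f g w \<noteq> 0" for w
    proof -
      obtain x r where w: "w = (x, r)" by (cases w)
      from that obtain i where "f (Q.awlast x (take i r), drop i r) * g (x, take i r) \<noteq> 0"
        unfolding path_mult_def w case_prod_conv by (meson sum.not_neutral_contains_not_neutral)
      then show ?thesis
        by (intro exI[of _ "(Q.awlast x (take i r), drop i r)"] exI[of _ "(x, take i r)"])
          (auto simp: w)
    qed
    have "{w. path_mult Q f g w \<noteq> 0} \<subseteq> (\<lambda>(q, p). (fst p, snd p @ snd q)) ` (?A \<times> ?B)"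
      using supp by force
    moreover have "finite (?A \<times> ?B)" using f g by (auto simp: path_algebra_def)
    ultimately have "finite {w. path_mult Q f g w \<noteq> 0}" by (meson finite_imageI finite_subset)
    moreover have "w \<in> paths Q" if nz: "path_mult Q f g w \<noteq> 0" for w
    proof -
      from supp[OF nz] obtain q p where w: "w = (fst p, snd p @ snd q)" "q \<in> ?A" "p \<in> ?B"
        "fst q = Q.awlast (fst p) (snd p)" by blast
      from w f g have "q \<in> paths Q" "p \<in> paths Q" by (auto simp: path_algebra_def)
      then obtain v v' where "Q.awalk (fst p) (snd p) v" "Q.awalk (fst q) (snd q) v'"
        by (auto simp: paths_def)
      then have "Q.awalk (fst p) (snd p @ snd q) v'" using w(4) by auto
      then show ?thesis by (auto simp: w(1) paths_def)
    qed
    ultimately show ?thesis by (auto simp: path_algebra_def)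
  qed
  have "(\<lambda>p. f p + g p) \<in> path_algebra Q"
    if "f \<in> path_algebra Q" "g \<in> path_algebra Q" for f g :: "('v, 'a) path \<Rightarrow> 'k"
  proof -
    have "{p. f p + g p \<noteq> 0} \<subseteq> {p. f p \<noteq> 0} \<union> {p. g p \<noteq> 0}" by auto
    moreover from that have "finite ({p. f p \<noteq> 0} \<union> {p. g p \<noteq> 0})"
      "{p. f p \<noteq> 0} \<union> {p. g p \<noteq> 0} \<subseteq> paths Q" by (auto simp: path_algebra_def)
    ultimately show ?thesis
      unfolding path_algebra_def mem_Collect_eq by (meson finite_subset order_trans)
  qed
  moreover have "(\<lambda>p. c * f p) \<in> path_algebra Q"
    if "f \<in> path_algebra Q" for c and f :: "('v, 'a) path \<Rightarrow> 'k"
    using that by (cases "c = 0") (auto simp: path_algebra_def)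
  ultimately show ?thesis
    unfolding two_sided_ideal_def using mult by (simp add: path_algebra_def)
qed

lemma arrow_action_unit_vec:
  assumes "finite (verts T)" and "n \<in> verts T"
  shows "arrow_action (tree_module T F) g (unit_vec n) =
    (\<lambda>k. \<Sum>a\<in>{a \<in> arcs T. tail T a = n \<and> amap F a = g}. unit_vec (head T a) k :: 'k::field)"
  using assms by (simp add: tree_module_def unit_vec_def if_distrib[of "\<lambda>x. x * _"] cong: if_cong)

lemma subnetwork_map_unit_vec:
  assumes "finite (verts (base_tree M1))" and "n \<in> verts (base_tree M1)"
  shows "subnetwork_map M1 M (unit_vec n) =
    (\<lambda>k. \<Sum>(m, j)\<in>{(m, j). (n, m, j) \<in> verts (quiver M)}. of_int j * unit_vec m k :: 'k::field)"
  using assms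
  by (simp add: subnetwork_map_def unit_vec_def[of n] if_distrib[of "\<lambda>x. x * _"] cong: if_cong)

lemma wf_pullback_network:
  assumes "wf_digraph T1" "wf_digraph T2" "quiver_morphism T1 Q F1" "quiver_morphism T2 Q F2"
  shows "wf_network (pullback_network T1 F1 T2 F2)"
proof -
  interpret T1: wf_digraph T1 by fact
  interpret T2: wf_digraph T2 by fact
  have "vmap F1 (tail T1 a) = vmap F2 (tail T2 b) \<and> vmap F1 (head T1 a) = vmap F2 (head T2 b)"
    if "a \<in> arcs T1" "b \<in> arcs T2" "amap F1 a = amap F2 b" for a b
    using that assms(3,4) unfolding quiver_morphism_def by metis
  then have "wf_digraph (quiver (pullback_network T1 F1 T2 F2))"
    by unfold_locales (auto simp: pullback_network_def)
  then show ?thesis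
    by (auto simp: wf_network_def pullback_network_def)
qed

lemma wf_covering_network:
  assumes "wf_digraph T1" "wf_digraph T2" "quiver_morphism T1 Q F1" "quiver_morphism T2 Q F2"
  shows "wf_network (covering_network T1 F1 T2 F2)"
proof -
  note wf = wf_pullback_network[OF assms]
  interpret N: wf_digraph "quiver (pullback_network T1 F1 T2 F2)"
    using wf by (simp add: wf_network_def)
  have "wf_digraph (quiver (covering_network T1 F1 T2 F2))"
  proof
    fix e assume "e \<in> arcs (quiver (covering_network T1 F1 T2 F2))"
    then obtain a b i where "e = (a, b, i)" "i \<in> {-1, 1}"
        "(a, b) \<in> arcs (quiver (pullback_network T1 F1 T2 F2))"
      by (auto simp: covering_network_def Let_def)
    with N.tail_in_verts[of "(a, b)"] N.head_in_verts[of "(a, b)"]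
    show "tail (quiver (covering_network T1 F1 T2 F2)) e \<in> verts (quiver (covering_network T1 F1 T2 F2))"
      "head (quiver (covering_network T1 F1 T2 F2)) e \<in> verts (quiver (covering_network T1 F1 T2 F2))"
      by (auto simp: covering_network_def Let_def pullback_network_def)
  qed
  moreover have "e \<subseteq> verts (quiver (covering_network T1 F1 T2 F2)) \<and> card e = 2"
    if "e \<in> edges (covering_network T1 F1 T2 F2)" for e
  proof -
    from that obtain n m m' i where "e = {(n, m, i), (n, m', - i)}" "i \<in> {-1, 1}"
        "{(n, m), (n, m')} \<in> edges (pullback_network T1 F1 T2 F2)"
      by (auto simp: covering_network_def Let_def)
    moreover from this wf have "{(n, m), (n, m')} \<subseteq> verts (quiver (pullback_network T1 F1 T2 F2))"
      unfolding wf_network_def by blast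
    ultimately show ?thesis by (auto simp: covering_network_def Let_def card_insert_if)
  qed
  ultimately show ?thesis by (auto simp: wf_network_def)
qed

end

theory Submission
  imports Defs
begin

text \<open>
  If the linear map of a ghost vanishes, the ghost contains \<open>(n, m, 1)\<close> and \<open>(n, m, -1)\<close> for some
  \<open>(n, m)\<close>, and hence a traversal between them. By triangle-freeness, an edge is followed neither by
  an edge nor by an arrow, and an inverse arrow is not followed by an edge. An inverse arrow followed
  by an arrow backtracks, as a vertex of a rooted tree has at most one outgoing arrow. So the traversal
  goes down along arrows, crosses at most one edge, and goes up along inverse arrows. As the
  sign changes, it does cross an edge. Returning to \<open>n\<close> makes the descent and the ascent equally long,
  and then both endpoints of the edge lie over the same ancestor of \<open>m\<close>, which is impossible.
\<close>

section \<open>Rooted trees\<close>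

lemma underlying_simps [simp]:
  "verts (underlying T) = verts T" "arcs (underlying T) = arcs T \<times> UNIV"
  "tail (underlying T) (a, d) = (if d then tail T a else head T a)"
  "head (underlying T) (a, d) = (if d then head T a else tail T a)"
  by (simp_all add: underlying_def)

context wf_digraph
begin

lemma wf_underlying: "wf_digraph (underlying G)"
  by unfold_locales (auto simp: underlying_def)

lemma underlying_awalk_forward:
  assumes "awalk u p v"
  shows "pre_digraph.awalk (underlying G) u (map (\<lambda>a. (a, True)) p) v"
    and "pre_digraph.awalk_verts (underlying G) u (map (\<lambda>a. (a, True)) p) = awalk_verts u p"
proof -
  interpret U: wf_digraph "underlying G" by (rule wf_underlying)
  show "U.awalk u (map (\<lambda>a. (a, True)) p) v"
    using assms by (induction p arbitrary: u) (auto simp: U.awalk_simps awalk_simps)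
  show "U.awalk_verts u (map (\<lambda>a. (a, True)) p) = awalk_verts u p"
    by (induction p arbitrary: u) auto
qed

lemma underlying_awalk_backward:
  assumes "awalk u p v"
  shows "pre_digraph.awalk (underlying G) v (rev (map (\<lambda>a. (a, False)) p)) u"
    and "pre_digraph.awalk_verts (underlying G) v (rev (map (\<lambda>a. (a, False)) p))
      = rev (awalk_verts u p)"
proof -
  interpret U: wf_digraph "underlying G" by (rule wf_underlying)
  \<comment> \<open>Both claims go through one induction, since the vertex list of an appended walk
    can be computed only once it is known to be a walk.\<close>
  have "U.awalk v (rev (map (\<lambda>a. (a, False)) p)) u \<and>
    U.awalk_verts v (rev (map (\<lambda>a. (a, False)) p)) = rev (awalk_verts u p)"
    using assms
  proof (induction p arbitrary: u)
    case Nil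
    then show ?case by (auto simp: U.awalk_simps awalk_simps)
  next
    case (Cons a p)
    then have a: "a \<in> arcs G" "u = tail G a" and
      IH: "U.awalk v (rev (map (\<lambda>a. (a, False)) p)) (head G a)"
        "U.awalk_verts v (rev (map (\<lambda>a. (a, False)) p)) = rev (awalk_verts (head G a) p)"
      by (auto simp: awalk_simps)
    have arc: "U.awalk (head G a) [(a, False)] u"
      using a by (auto simp: U.awalk_simps)
    have walk: "U.awalk v (rev (map (\<lambda>a. (a, False)) p) @ [(a, False)]) u"
      using U.awalk_appendI[OF IH(1) arc] .
    moreover have "U.awlast v (rev (map (\<lambda>a. (a, False)) p)) = head G a"
      using IH(1) by simp
    ultimately show ?case
      using U.awalk_verts_append[OF walk] IH(2) a by simp
  qed
  then show "U.awalk v (rev (map (\<lambda>a. (a, False)) p)) u"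
    "U.awalk_verts v (rev (map (\<lambda>a. (a, False)) p)) = rev (awalk_verts u p)" by auto
qed

text \<open>A nonempty closed walk contains a directed cycle. Its arcs are distinct, so traversing
  them forwards gives an undirected cycle.\<close>

lemma no_closed_awalk:
  assumes "\<nexists>p. undirected_cycle G p" "awalk u p u"
  shows "p = []"
proof (rule ccontr)
  assume "p \<noteq> []"
  then obtain q where q: "cycle q"
    using assms closed_w_imp_cycle[of p] by (auto simp: closed_w_def)
  then obtain x where x: "awalk x q x" "distinct (tl (awalk_verts x q))" "q \<noteq> []"
    by (auto simp: cycle_def)
  interpret U: wf_digraph "underlying G" by (rule wf_underlying)
  have "distinct q" using q by (auto simp: cycle_conv)
  then have "undirected_cycle G (map (\<lambda>a. (a, True)) q)"
    using x underlying_awalk_forward[OF x(1)]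
    by (auto simp: undirected_cycle_def U.cycle_def comp_def)
  with assms(1) show False by blast
qed

lemma acyclic_arcs_ends:
  assumes "\<nexists>p. undirected_cycle G p"
  shows "acyclic (arcs_ends G)"
  using no_closed_awalk[OF assms] by (auto simp: acyclic_def reachable1_awalk)

text \<open>
  Two walks with the same ends and different first arcs whose total length is minimal meet only at
  their ends, so they form an undirected cycle.
\<close>

lemma unique_first_arc:
  assumes "\<nexists>p. undirected_cycle G p" "awalk u (a # p) v" "awalk u (b # q) v"
  shows "a = b"
  using assms(2,3)
proof (induction "length p + length q" arbitrary: v p q rule: less_induct)
  case less
  show ?case
  proof (rule ccontr)
    assume "a \<noteq> b"
    let ?P = "awalk_verts (head G a) p" and ?Q = "awalk_verts (head G b) q"
    have p: "awalk (head G a) p v" "a \<in> arcs G" "tail G a = u"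
      and q: "awalk (head G b) q v" "b \<in> arcs G" "tail G b = u"
      using less.prems by (auto simp: awalk_simps)
    \<comment> \<open>Cutting both walks at a common vertex \<open>x\<close> keeps their first arcs.
      The induction hypothesis forbids a shorter such pair, so nothing is cut off and
      \<open>x\<close> is the end \<open>v\<close>.\<close>
    have meet: "x = v" if xP: "x \<in> set ?P" and xQ: "x \<in> set ?Q" for x
    proof -
      obtain p1 p2 where p12: "p = p1 @ p2" "awalk (head G a) p1 x" "awalk x p2 v"
        using awalk_decomp[OF p(1) xP] by blast
      obtain q1 q2 where q12: "q = q1 @ q2" "awalk (head G b) q1 x" "awalk x q2 v"
        using awalk_decomp[OF q(1) xQ] by blast
      have "awalk u (a # p1) x" "awalk u (b # q1) x"
        using p q p12 q12 by (auto simp: awalk_simps)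
      then have "\<not> length p1 + length q1 < length p + length q"
        using less.hyps \<open>a \<noteq> b\<close> by blast
      then have "p2 = []" using p12 q12 by simp
      then show ?thesis using p12 by (simp add: awalk_simps)
    qed
    have closed: "r = []" if "awalk x r x" for x r
      using no_closed_awalk[OF assms(1) that] .
    have distinct_walk: "distinct (awalk_verts x r)" if "awalk x r y" for x r y
      using awalk_not_distinct_decomp[OF that] closed by (auto simp: closed_w_def)
    have u_notin: "u \<notin> set (awalk_verts (head G c) r)"
      if c: "c \<in> arcs G" "tail G c = u" "awalk (head G c) r y" for c r y
    proof
      assume "u \<in> set (awalk_verts (head G c) r)"
      then obtain r1 where "awalk (head G c) r1 u"
        using awalk_decomp[OF c(3)] by blast
      then have "awalk u (c # r1) u" using c by (auto simp: awalk_simps)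
      then show False using closed by blast
    qed
    have uP: "u \<notin> set ?P" and uQ: "u \<notin> set ?Q"
      using u_notin p q by blast+
    \<comment> \<open>Both ends of a shared arc lie on both walks, so both are \<open>v\<close> and
      the arc is a loop.\<close>
    have common: False if "c \<in> set p" "c \<in> set q" for c
    proof -
      have "c \<in> arcs G" using that p(1) by auto
      moreover have "tail G c = v" "head G c = v"
        using meet awalk_verts_arc1 awalk_verts_arc2 that p(1) q(1) by blast+
      ultimately have "awalk v [c] v" by (auto simp: awalk_simps)
      then show False using closed by blast
    qed
    have ab: "a \<notin> set p" "a \<notin> set q" "b \<notin> set p" "b \<notin> set q"
      using uP uQ p(3) q(3) awalk_verts_arc1 by metis+
    have dPQ: "distinct ?P" "distinct ?Q" using distinct_walk p(1) q(1) by blast+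
    then have dpq: "distinct p" "distinct q"
      using p(1) q(1) distinct_verts_imp_distinct by blast+
    interpret U: wf_digraph "underlying G" by (rule wf_underlying)
    \<comment> \<open>The candidate cycle: out along the first walk, back against the
      second.\<close>
    let ?f = "map (\<lambda>a. (a, True)) (a # p)" and ?g = "rev (map (\<lambda>a. (a, False)) (b # q))"
    note f = underlying_awalk_forward[OF less.prems(1)]
    note g = underlying_awalk_backward[OF less.prems(2)]
    have fg: "U.awalk u (?f @ ?g) u" using U.awalk_appendI[OF f(1) g(1)] .
    have "U.awlast u ?f = v" by (rule U.awlast_of_awalk[OF f(1)]) (simp add: NOMATCH_def)
    then have verts_fg: "tl (U.awalk_verts u (?f @ ?g)) = ?P @ tl (rev ?Q) @ [u]"
      using U.awalk_verts_append[OF fg] f(2) g(2) p q by simp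
    \<comment> \<open>Both walks end in \<open>v\<close>, so \<open>v\<close> is split off:
      \<open>tl (rev ?Q)\<close> is \<open>rev Q'\<close>, which avoids \<open>v\<close> and hence,
      by \<open>meet\<close>, all of \<open>?P\<close>.\<close>
    have "last ?Q = v" using q(1) by auto
    then obtain Q' where Q': "?Q = Q' @ [v]"
      by (metis append_butlast_last_id awalk_verts_non_Nil)
    have "distinct (?P @ tl (rev ?Q) @ [u])"
      using dPQ uP uQ meet by (auto simp: Q')
    moreover have "distinct (map fst (?f @ ?g))"
      using dpq ab common \<open>a \<noteq> b\<close> by (auto simp: comp_def rev_map)
    ultimately have "undirected_cycle G (?f @ ?g)"
      using fg verts_fg by (auto simp: undirected_cycle_def U.cycle_def)
    with assms(1) show False by blast
  qed
qed

end

section \<open>Acyclicity and uniqueness of outgoing arrows in rooted trees\<close>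

lemma rooted_tree_acyclic:
  assumes "rooted_tree T"
  shows "acyclic (arcs_ends T)"
proof -
  interpret fin_digraph T using assms by (simp add: rooted_tree_def tree_quiver_def)
  show ?thesis
    using assms acyclic_arcs_ends by (simp add: rooted_tree_def tree_quiver_def)
qed

text \<open>Both arcs extend to walks from their common tail to the root, and such walks share their
  first arc.\<close>

lemma rooted_tree_tail_inject:
  assumes "rooted_tree T" "a \<in> arcs T" "b \<in> arcs T" "tail T a = tail T b"
  shows "a = b"
proof -
  interpret fin_digraph T using assms(1) by (simp add: rooted_tree_def tree_quiver_def)
  obtain r where r: "\<And>x. x \<in> verts T \<Longrightarrow> out_arcs T x = {} \<Longrightarrow> x = r"
    using assms(1) by (auto simp: rooted_tree_def)
  \<comment> \<open>A finite acyclic relation has a well-founded converse, so following outgoing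
    arcs stops. It can stop only at a sink, and the only sink is \<open>r\<close>.\<close>
  have "finite (arcs_ends T)" by (simp add: arcs_ends_def)
  then have "wf ((arcs_ends T)\<inverse>)"
    using rooted_tree_acyclic[OF assms(1)] by (rule finite_acyclic_wf_converse)
  then have to_root: "x \<in> verts T \<longrightarrow> (\<exists>p. awalk x p r)" for x
  proof (induction x rule: wf_induct_rule)
    case (less x)
    show ?case
    proof
      assume x: "x \<in> verts T"
      show "\<exists>p. awalk x p r"
      proof (cases "out_arcs T x = {}")
        case True
        then show ?thesis using r x by (auto simp: awalk_simps intro: exI[of _ "[]"])
      next
        case False
        then obtain c where "c \<in> out_arcs T x" by blast
        then have c: "c \<in> arcs T" "tail T c = x" by auto
        then have "(head T c, x) \<in> (arcs_ends T)\<inverse>" by (auto simp: arcs_ends_conv)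
        then obtain p where "awalk (head T c) p r"
          using less.IH[of "head T c"] c(1) head_in_verts by blast
        then have "awalk x (c # p) r" using c by (auto simp: awalk_simps)
        then show ?thesis by blast
      qed
    qed
  qed
  obtain p q where "awalk (head T a) p r" "awalk (head T b) q r"
    using to_root assms by (meson head_in_verts)
  then have "awalk (tail T a) (a # p) r" "awalk (tail T a) (b # q) r"
    using assms by (auto simp: awalk_simps)
  then show ?thesis
    using unique_first_arc assms(1) by (metis rooted_tree_def tree_quiver_def)
qed

section \<open>Triangle-free traversals\<close>

lemma link_joins_inverse_end:
  assumes "link_joins N l u v" "link_joins N (link_inverse l) v w"
  shows "u = w"
  using assms by (cases l) (auto simp: doubleton_eq_iff)

lemma link_joins_in_verts:
  assumes "wf_network N" "link_joins N l u v"
  shows "u \<in> verts (quiver N)" "v \<in> verts (quiver N)"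
proof -
  interpret wf_digraph "quiver N" using assms(1) by (simp add: wf_network_def)
  show "u \<in> verts (quiver N)" "v \<in> verts (quiver N)"
    using assms by (cases l; auto simp: wf_network_def)+
qed

lemma link_joins_subnetwork:
  assumes "subnetwork M N" "link_joins M l u v"
  shows "link_joins N l u v"
  using assms by (cases l) (auto simp: subnetwork_def subgraph_def compatible_def)

text \<open>Distinct outer ends rule out backtracking, because the inverse of a link leads back to
  where the link started.\<close>

lemma traversal_two_links:
  assumes "wf_network N" "link_joins N l u v" "link_joins N l' v w" "u \<noteq> w"
  shows "(u, [l, l']) \<in> traversals N"
proof -
  have "w \<in> verts (quiver N)" using link_joins_in_verts(2) assms by metis
  moreover have "l' \<noteq> link_inverse l" using link_joins_inverse_end assms by metis
  ultimately have "traversal N u [l, l'] w"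
    using assms by (auto simp: traversal_def)
  then show ?thesis by (auto simp: traversals_def)
qed

lemma traversal_Cons:
  assumes "traversal N u (l # ls) v"
  obtains w where "link_joins N l u w" "traversal N w ls v"
  using assms by (fastforce simp: traversal_def)

lemma traversal_no_backtrack:
  assumes "traversal N u (l # l' # ls) v"
  shows "l' \<noteq> link_inverse l"
  using assms by (auto simp: traversal_def)

lemma card_pairs:
  assumes "x \<noteq> y" "y \<noteq> z" "x \<noteq> z"
  shows "card {{x, y}, {y, z}, {x, z}} = 3"
  using assms by (simp add: doubleton_eq_iff)

text \<open>Collects the consequences of the tree structure on which the network arguments
  rest.\<close>

locale pullback_pair = T1: wf_digraph T1 + T2: wf_digraph T2
  for T1 :: "('v1, 'e1) pre_digraph" and T2 :: "('v2, 'e2) pre_digraph" +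
  fixes Q :: "('w, 'a) pre_digraph"
    and F1 :: "('v1, 'e1, 'w, 'a) quiver_map" and F2 :: "('v2, 'e2, 'w, 'a) quiver_map"
  assumes morphism1: "quiver_morphism T1 Q F1" and morphism2: "quiver_morphism T2 Q F2"
    and acyclic1: "acyclic (arcs_ends T1)"
    and tail_inject1: "\<And>a b. a \<in> arcs T1 \<Longrightarrow> b \<in> arcs T1 \<Longrightarrow> tail T1 a = tail T1 b \<Longrightarrow> a = b"
    and tail_inject2: "\<And>a b. a \<in> arcs T2 \<Longrightarrow> b \<in> arcs T2 \<Longrightarrow> tail T2 a = tail T2 b \<Longrightarrow> a = b"
begin

abbreviation "N1 \<equiv> pullback_network T1 F1 T2 F2"
abbreviation "N2 \<equiv> covering_network T1 F1 T2 F2"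

text \<open>The edge relation of the pullback network, stated for arrows of \<open>T2\<close>: a
  non-root vertex is represented by its outgoing arrow, which also gives access to its parent and
  its label in \<open>Q\<close>.\<close>

definition siblings :: "'v1 \<Rightarrow> 'e2 \<Rightarrow> 'e2 \<Rightarrow> bool" where
  "siblings n b b' \<longleftrightarrow> n \<in> verts T1 \<and> b \<in> arcs T2 \<and> b' \<in> arcs T2 \<and>
     vmap F1 n = vmap F2 (tail T2 b) \<and> vmap F1 n = vmap F2 (tail T2 b') \<and>
     tail T2 b \<noteq> tail T2 b' \<and> head T2 b = head T2 b' \<and> amap F2 b = amap F2 b'"

lemma siblings_sym: "siblings n b b' \<Longrightarrow> siblings n b' b"
  by (auto simp: siblings_def)

lemma edges_N1: "edges N1 = {{(n, tail T2 b), (n, tail T2 b')} | n b b'. siblings n b b'}"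
  by (simp add: pullback_network_def siblings_def)

lemma arcs_induced_N1:
  "(c, d) \<in> arcs (quiver (induced_subnetwork N1 S)) \<longleftrightarrow>
    c \<in> arcs T1 \<and> d \<in> arcs T2 \<and> amap F1 c = amap F2 d \<and>
    (tail T1 c, tail T2 d) \<in> S \<and> (head T1 c, head T2 d) \<in> S"
  by (auto simp: induced_subnetwork_def pullback_network_def)

lemma edges_induced_N1E:
  assumes "e \<in> edges (induced_subnetwork N1 S)"
  obtains n b b' where "siblings n b b'" "e = {(n, tail T2 b), (n, tail T2 b')}"
    "(n, tail T2 b) \<in> S" "(n, tail T2 b') \<in> S"
  using assms by (auto simp: induced_subnetwork_def edges_N1)

lemma edges_induced_N1I:
  assumes "siblings n b b'" "(n, tail T2 b) \<in> S" "(n, tail T2 b') \<in> S"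
  shows "{(n, tail T2 b), (n, tail T2 b')} \<in> edges (induced_subnetwork N1 S)"
  using assms by (auto simp: induced_subnetwork_def edges_N1)

lemma wf_N2: "wf_network N2"
  using wf_covering_network[OF T1.wf_digraph_axioms T2.wf_digraph_axioms morphism1 morphism2] .

section \<open>Triangles in the pullback network\<close>

lemma arc_ends_neq:
  assumes "a \<in> arcs T1"
  shows "tail T1 a \<noteq> head T1 a"
  using acyclic1 assms by (metis T1.in_arcs_imp_in_arcs_ends acyclic_def r_into_trancl')

lemma no_antiparallel:
  assumes "a \<in> arcs T1" "c \<in> arcs T1" "tail T1 c = head T1 a"
  shows "head T1 c \<noteq> tail T1 a"
proof
  assume "head T1 c = tail T1 a"
  with assms have "(tail T1 a, head T1 a) \<in> arcs_ends T1" "(head T1 a, tail T1 a) \<in> arcs_ends T1"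
    using T1.in_arcs_imp_in_arcs_ends by metis+
  then show False using acyclic1 by (meson acyclic_def trancl.simps)
qed

text \<open>Since \<open>b\<close> and \<open>b'\<close> have the same head and label,
  \<open>(a, b)\<close> and \<open>(a, b')\<close> are arrows from the two ends of an edge to one
  common vertex. The triangle consists of these two arrows and that edge.\<close>

lemma triangle_arrows:
  assumes "siblings (tail T1 a) b b'" "a \<in> arcs T1" "amap F1 a = amap F2 b"
  shows "induces_triangle N1 {(tail T1 a, tail T2 b), (tail T1 a, tail T2 b'), (head T1 a, head T2 b)}"
    (is "induces_triangle _ ?S")
proof -
  note b = assms(1)[unfolded siblings_def]
  note neq = arc_ends_neq[OF assms(2)]
  have "arcs (quiver (induced_subnetwork N1 ?S)) = {(a, b), (a, b')}"
  proof -
    have "(c, d) = (a, b) \<or> (c, d) = (a, b')"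
      if c: "c \<in> arcs T1" "d \<in> arcs T2"
        "(tail T1 c, tail T2 d) \<in> ?S" "(head T1 c, head T2 d) \<in> ?S" for c d
    proof -
      \<comment> \<open>Otherwise \<open>c\<close> would be a loop or run antiparallel to
        \<open>a\<close>, against acyclicity.\<close>
      have "tail T1 c \<noteq> head T1 a"
        using c arc_ends_neq[OF c(1)] no_antiparallel[OF assms(2) c(1)] by auto
      then have "tail T1 c = tail T1 a" "tail T2 d = tail T2 b \<or> tail T2 d = tail T2 b'"
        using c(3) by auto
      then show ?thesis using tail_inject1 tail_inject2 c b assms(2) by metis
    qed
    then have "p \<in> {(a, b), (a, b')}" if "p \<in> arcs (quiver (induced_subnetwork N1 ?S))" for p
      using that arcs_induced_N1[of "fst p" "snd p" ?S] by (metis insertCI prod.collapse)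
    moreover have "(a, b) \<in> arcs (quiver (induced_subnetwork N1 ?S))"
      "(a, b') \<in> arcs (quiver (induced_subnetwork N1 ?S))"
      using assms b by (simp_all add: arcs_induced_N1)
    ultimately show ?thesis by blast
  qed
  moreover have "edges (induced_subnetwork N1 ?S) = {{(tail T1 a, tail T2 b), (tail T1 a, tail T2 b')}}"
  proof -
    have "e = {(tail T1 a, tail T2 b), (tail T1 a, tail T2 b')}"
      if "e \<in> edges (induced_subnetwork N1 ?S)" for e
    proof -
      \<comment> \<open>The ends of an edge share their first coordinate, and only one vertex of
        \<open>?S\<close> lies over \<open>head T1 a\<close>.\<close>
      obtain n d d' where d: "siblings n d d'" "e = {(n, tail T2 d), (n, tail T2 d')}"
          "(n, tail T2 d) \<in> ?S" "(n, tail T2 d') \<in> ?S"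
        using \<open>e \<in> _\<close> by (rule edges_induced_N1E)
      then show ?thesis using neq by (auto simp: siblings_def)
    qed
    moreover have "{(tail T1 a, tail T2 b), (tail T1 a, tail T2 b')} \<in> edges (induced_subnetwork N1 ?S)"
      using assms(1) by (rule edges_induced_N1I) simp_all
    ultimately show ?thesis by blast
  qed
  moreover have "vmap F1 (head T1 a) = vmap F2 (head T2 b)"
    using morphism1 morphism2 assms b unfolding quiver_morphism_def by metis
  then have "?S \<subseteq> verts (quiver N1)"
    using assms(2) b by (auto simp: pullback_network_def)
  moreover have "card ?S = 3" using neq b by (simp add: card_insert_if)
  moreover have "card {(a, b), (a, b')} = 2" using b by (auto simp: card_insert_if)
  ultimately show ?thesis by (simp add: induces_triangle_def)
qed

text \<open>Being siblings is transitive as long as the outer vertices differ, which supplies the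
  third edge. All three vertices lie over \<open>n\<close>, so an arrow between them would project
  to a loop in \<open>T1\<close>.\<close>

lemma triangle_edges:
  assumes "siblings n b b'" "siblings n b' b''" "tail T2 b \<noteq> tail T2 b''"
  shows "induces_triangle N1 {(n, tail T2 b), (n, tail T2 b'), (n, tail T2 b'')}"
    (is "induces_triangle _ ?S")
proof -
  let ?x = "(n, tail T2 b)" and ?y = "(n, tail T2 b')" and ?z = "(n, tail T2 b'')"
  have third: "siblings n b b''" using assms by (auto simp: siblings_def)
  have "arcs (quiver (induced_subnetwork N1 ?S)) = {}"
    using arc_ends_neq by (fastforce simp: induced_subnetwork_def pullback_network_def)
  moreover have "edges (induced_subnetwork N1 ?S) = {{?x, ?y}, {?y, ?z}, {?x, ?z}}"
  proof -
    have "e \<in> {{?x, ?y}, {?y, ?z}, {?x, ?z}}" if "e \<in> edges (induced_subnetwork N1 ?S)" for e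
    proof -
      obtain m d d' where d: "siblings m d d'" "e = {(m, tail T2 d), (m, tail T2 d')}"
          "(m, tail T2 d) \<in> ?S" "(m, tail T2 d') \<in> ?S"
        using \<open>e \<in> _\<close> by (rule edges_induced_N1E)
      have "(m, tail T2 d) \<noteq> (m, tail T2 d')" using d(1) by (simp add: siblings_def)
      with d(2-4) show ?thesis by (elim insertE emptyE) (simp_all add: insert_commute)
    qed
    moreover have "{?x, ?y} \<in> edges (induced_subnetwork N1 ?S)"
      "{?y, ?z} \<in> edges (induced_subnetwork N1 ?S)" "{?x, ?z} \<in> edges (induced_subnetwork N1 ?S)"
      using assms third by (auto intro: edges_induced_N1I)
    ultimately show ?thesis by blast
  qed
  moreover have "card {{?x, ?y}, {?y, ?z}, {?x, ?z}} = 3"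
    by (rule card_pairs) (use assms in \<open>simp_all add: siblings_def\<close>)
  moreover have "?S \<subseteq> verts (quiver N1)"
    using assms by (auto simp: siblings_def pullback_network_def)
  moreover have "card ?S = 3" using assms by (simp add: siblings_def card_insert_if)
  ultimately show ?thesis by (simp add: induces_triangle_def)
qed

section \<open>Projections of the 2-covering network\<close>

lemma covering_arcD:
  assumes "\<alpha> \<in> arcs (quiver N2)"
  obtains a b i where "\<alpha> = (a, b, i)" "a \<in> arcs T1" "b \<in> arcs T2" "amap F1 a = amap F2 b"
    "tail (quiver N2) \<alpha> = (tail T1 a, tail T2 b, i)" "head (quiver N2) \<alpha> = (head T1 a, head T2 b, i)"
  using assms by (auto simp: covering_network_def pullback_network_def)

lemma covering_edgeD:
  assumes "link_joins N2 (Edge e) u v"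
  obtains n b b' i where "siblings n b b'" "u = (n, tail T2 b, i)" "v = (n, tail T2 b', - i)"
proof -
  obtain n m m' i where e: "{u, v} = {(n, m, i), (n, m', - i)}" "{(n, m), (n, m')} \<in> edges N1"
    using assms by (auto simp: covering_network_def Let_def)
  then obtain b b' where b: "siblings n b b'" "m = tail T2 b" "m' = tail T2 b'"
    using siblings_sym unfolding edges_N1 by (auto simp: doubleton_eq_iff) blast+
  \<comment> \<open>The unordered pair can be read in two ways; the swapped reading exchanges
    \<open>b\<close> and \<open>b'\<close> and negates the sign.\<close>
  show ?thesis
    using e b that[of n b b' i] that[of n b' b "- i"] siblings_sym[OF b(1)]
    by (auto simp: doubleton_eq_iff)
qed

lemma covering_link_joins_forget_sign:
  assumes "link_joins N2 l u v"
  shows "link_joins N1 (forget_sign_link l) (forget_sign u) (forget_sign v)"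
proof (cases l)
  case (Edge e)
  obtain n b b' i where "siblings n b b'" "u = (n, tail T2 b, i)" "v = (n, tail T2 b', - i)"
    using assms unfolding Edge by (rule covering_edgeD)
  moreover have "e = {u, v}" using assms Edge by simp
  ultimately show ?thesis
    unfolding Edge by (auto simp: forget_sign_def edges_N1)
qed (use assms in \<open>auto simp: covering_network_def pullback_network_def forget_sign_def\<close>)

lemma wf_N1: "wf_network N1"
  using wf_pullback_network[OF T1.wf_digraph_axioms T2.wf_digraph_axioms morphism1 morphism2] .

text \<open>The vertices of a triangle are distinct even after the sign is forgotten, so neither the
  two links nor their projections backtrack.\<close>

lemma covering_triangle_traversalI:
  assumes "link_joins N2 l u v" "link_joins N2 l' v w"
    and triangle: "induces_triangle N1 {forget_sign u, forget_sign v, forget_sign w}"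
  shows "(u, [l, l']) \<in> covering_triangle_traversals T1 F1 T2 F2"
proof -
  have neq: "forget_sign u \<noteq> forget_sign w"
    using triangle by (auto simp: induces_triangle_def card_insert_if split: if_splits)
  then have "(u, [l, l']) \<in> traversals N2"
    using traversal_two_links[OF wf_N2 assms(1,2)] by blast
  moreover note joins = assms(1,2)[THEN covering_link_joins_forget_sign]
  have "(forget_sign u, [forget_sign_link l, forget_sign_link l']) \<in> traversals N1"
    using traversal_two_links[OF wf_N1 joins neq] .
  ultimately show ?thesis
    using joins triangle
    unfolding covering_triangle_traversals_def triangle_traversals_def mem_Collect_eq case_prod_conv
      list.map by blast
qed

text \<open>Powers are used instead of the transitive closure because the number of steps must
  survive the projection: it is compared in \<open>T1\<close> and then used in
  \<open>T2\<close>.\<close>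

lemma covering_relpow:
  assumes "(u, v) \<in> arcs_ends (quiver N2) ^^ k"
  shows "(fst u, fst v) \<in> arcs_ends T1 ^^ k" "(fst (snd u), fst (snd v)) \<in> arcs_ends T2 ^^ k"
    "snd (snd u) = snd (snd v)"
proof -
  have "(fst u, fst v) \<in> arcs_ends T1 ^^ k \<and> (fst (snd u), fst (snd v)) \<in> arcs_ends T2 ^^ k \<and>
    snd (snd u) = snd (snd v)"
    using assms
  proof (induction k arbitrary: v)
    case 0
    then show ?case by simp
  next
    case (Suc k)
    then obtain w where w: "(u, w) \<in> arcs_ends (quiver N2) ^^ k" "(w, v) \<in> arcs_ends (quiver N2)"
      by auto
    then obtain \<alpha> where "\<alpha> \<in> arcs (quiver N2)" "w = tail (quiver N2) \<alpha>" "v = head (quiver N2) \<alpha>"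
      by (auto simp: arcs_ends_conv)
    then have "(fst w, fst v) \<in> arcs_ends T1" "(fst (snd w), fst (snd v)) \<in> arcs_ends T2"
      "snd (snd w) = snd (snd v)"
      by (auto elim!: covering_arcD simp: arcs_ends_conv)
    then show ?case using Suc.IH[OF w(1)] by auto
  qed
  then show "(fst u, fst v) \<in> arcs_ends T1 ^^ k"
    "(fst (snd u), fst (snd v)) \<in> arcs_ends T2 ^^ k" "snd (snd u) = snd (snd v)" by auto
qed

end

section \<open>Which links can follow each other in a triangle-free subnetwork\<close>

locale triangle_free_subnetwork = pullback_pair T1 T2 Q F1 F2
  for T1 :: "('v1, 'e1) pre_digraph" and T2 :: "('v2, 'e2) pre_digraph"
    and Q :: "('w, 'a) pre_digraph"
    and F1 :: "('v1, 'e1, 'w, 'a) quiver_map" and F2 :: "('v2, 'e2, 'w, 'a) quiver_map" +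
  fixes M :: "('v1 \<times> 'v2 \<times> int, 'e1 \<times> 'e2 \<times> int) network"
  assumes sub: "subnetwork M N2"
    and triangle_free: "traversals M \<inter> covering_triangle_traversals T1 F1 T2 F2 = {}"
begin

lemma covering_link: "link_joins M l u v \<Longrightarrow> link_joins N2 l u v"
  using sub by (rule link_joins_subnetwork)

text \<open>The form in which triangle-freeness is applied: the shape of the three projected
  vertices alone yields a forbidden traversal.\<close>

lemma no_triangle:
  assumes "link_joins M l u v" "link_joins M l' v w"
    and triangle: "induces_triangle N1 {forget_sign u, forget_sign v, forget_sign w}"
  shows False
proof -
  have "u \<noteq> w"
    using triangle by (auto simp: induces_triangle_def card_insert_if split: if_splits)
  then have "(u, [l, l']) \<in> traversals M"
    using traversal_two_links assms(1,2) sub by (auto simp: subnetwork_def)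
  moreover have "(u, [l, l']) \<in> covering_triangle_traversals T1 F1 T2 F2"
    using covering_triangle_traversalI[OF covering_link covering_link] assms by blast
  ultimately show False using triangle_free by blast
qed

text \<open>The arrow of \<open>T2\<close> behind the inverse link and the one behind the edge both
  leave the second coordinate of \<open>v\<close>, so they agree. Then arrow and edge are two sides
  of a triangle.\<close>

lemma inverse_then_edge:
  assumes "link_joins M (Formal_Inverse \<alpha>) u v" "link_joins M (Edge e) v w"
  shows False
proof -
  obtain a b i where a: "a \<in> arcs T1" "b \<in> arcs T2" "amap F1 a = amap F2 b"
      "v = (tail T1 a, tail T2 b, i)" "u = (head T1 a, head T2 b, i)"
    using covering_link[OF assms(1)] by (auto elim!: covering_arcD)
  obtain n d d' j where d: "siblings n d d'" "v = (n, tail T2 d, j)" "w = (n, tail T2 d', - j)"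
    using covering_link[OF assms(2)] by (rule covering_edgeD)
  have "d = b" using a d tail_inject2 by (auto simp: siblings_def)
  then have "induces_triangle N1
      {(tail T1 a, tail T2 b), (tail T1 a, tail T2 d'), (head T1 a, head T2 b)}"
    using triangle_arrows a d by auto
  then have "induces_triangle N1 {forget_sign u, forget_sign v, forget_sign w}"
    using a d by (simp add: forget_sign_def insert_commute)
  then show False using no_triangle assms by blast
qed

text \<open>The mirror image of \<open>inverse_then_edge\<close>, with the same triangle run through
  in the opposite direction.\<close>

lemma edge_then_arrow:
  assumes "link_joins M (Edge e) u v" "link_joins M (Arrow \<alpha>) v w"
  shows False
proof -
  obtain a b i where a: "a \<in> arcs T1" "b \<in> arcs T2" "amap F1 a = amap F2 b"
      "v = (tail T1 a, tail T2 b, i)" "w = (head T1 a, head T2 b, i)"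
    using covering_link[OF assms(2)] by (auto elim!: covering_arcD)
  obtain n d d' j where d: "siblings n d d'" "u = (n, tail T2 d, j)" "v = (n, tail T2 d', - j)"
    using covering_link[OF assms(1)] by (rule covering_edgeD)
  have "d' = b" using a d tail_inject2 by (auto simp: siblings_def)
  then have "induces_triangle N1
      {(tail T1 a, tail T2 b), (tail T1 a, tail T2 d), (head T1 a, head T2 b)}"
    using triangle_arrows a d siblings_sym by auto
  then have "induces_triangle N1 {forget_sign u, forget_sign v, forget_sign w}"
    using a d by (simp add: forget_sign_def insert_commute)
  then show False using no_triangle assms by blast
qed

lemma edge_then_edge:
  assumes "link_joins M (Edge e) u v" "link_joins M (Edge e') v w"
  shows "e = e'"
proof (rule ccontr)
  assume "e \<noteq> e'"
  then have "u \<noteq> w" using assms by auto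
  obtain n d d' j where d: "siblings n d d'" "u = (n, tail T2 d, j)" "v = (n, tail T2 d', - j)"
    using covering_link[OF assms(1)] by (rule covering_edgeD)
  obtain n2 c c' j2 where c: "siblings n2 c c'" "v = (n2, tail T2 c, j2)" "w = (n2, tail T2 c', - j2)"
    using covering_link[OF assms(2)] by (rule covering_edgeD)
  \<comment> \<open>Two edges restore the sign, so \<open>u\<close> and \<open>w\<close> can differ
    only in their vertex of \<open>T2\<close>.\<close>
  have "c = d'" using c d tail_inject2 by (auto simp: siblings_def)
  then have "siblings n d' c'" "tail T2 d \<noteq> tail T2 c'"
    using c d \<open>u \<noteq> w\<close> by auto
  then have "induces_triangle N1 {forget_sign u, forget_sign v, forget_sign w}"
    using triangle_edges[OF d(1)] c d by (simp add: forget_sign_def)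
  then show False using no_triangle assms by blast
qed

text \<open>Both arrows leave \<open>v\<close>: each tree has at most one arrow out of a given
  vertex, and \<open>v\<close> determines the sign.\<close>

lemma inverse_then_arrow:
  assumes "link_joins M (Formal_Inverse \<alpha>) u v" "link_joins M (Arrow \<beta>) v w"
  shows "\<alpha> = \<beta>"
  using covering_link[OF assms(1)] covering_link[OF assms(2)] tail_inject1 tail_inject2
  by (auto elim!: covering_arcD)

section \<open>The global shape of traversals\<close>

lemma arrow_arcs_ends:
  assumes "link_joins M (Arrow \<alpha>) u v"
  shows "(u, v) \<in> arcs_ends (quiver N2)"
  using covering_link[OF assms] by (auto simp: arcs_ends_conv)

text \<open>After an inverse arrow only inverse arrows can follow, so the whole traversal, read
  backwards, is a directed path.\<close>

lemma traversal_from_inverse: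
  assumes "traversal M u (Formal_Inverse \<alpha> # ls) v"
  shows "\<exists>k. (v, u) \<in> arcs_ends (quiver N2) ^^ k"
  using assms
proof (induction ls arbitrary: u \<alpha>)
  case Nil
  then have "link_joins M (Arrow \<alpha>) v u" by (auto simp: traversal_def)
  then have "(v, u) \<in> arcs_ends (quiver N2) ^^ 1"
    unfolding relpow_1 by (rule arrow_arcs_ends)
  then show ?case by blast
next
  case (Cons l ls)
  obtain w where w: "link_joins M (Formal_Inverse \<alpha>) u w" "traversal M w (l # ls) v"
    using Cons.prems by (rule traversal_Cons)
  obtain x where x: "link_joins M l w x"
    using w(2) by (rule traversal_Cons)
  \<comment> \<open>Any arrow in this place would have to be \<alpha> itself, which is
    backtracking.\<close>
  have "l \<noteq> Arrow \<alpha>" using traversal_no_backtrack[OF Cons.prems] by simp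
  then have "l \<noteq> Arrow \<beta>" for \<beta> using inverse_then_arrow[OF w(1)] x by blast
  moreover have "l \<noteq> Edge e" for e using inverse_then_edge[OF w(1)] x by blast
  ultimately obtain \<beta> where "l = Formal_Inverse \<beta>" by (cases l) auto
  then obtain k where "(v, w) \<in> arcs_ends (quiver N2) ^^ k" using Cons.IH w(2) by blast
  moreover have "(w, u) \<in> arcs_ends (quiver N2)"
    by (rule arrow_arcs_ends[of \<alpha>]) (use w(1) in simp)
  ultimately have "(v, u) \<in> arcs_ends (quiver N2) ^^ Suc k" by auto
  then show ?case by blast
qed

text \<open>A second edge would be the same edge again, hence its own inverse, and an arrow would
  complete a triangle. Only an ascent remains.\<close>

lemma traversal_from_edge:
  assumes "traversal M u (Edge e # ls) v"
  shows "\<exists>w k. link_joins M (Edge e) u w \<and> (v, w) \<in> arcs_ends (quiver N2) ^^ k"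
proof -
  obtain w where w: "link_joins M (Edge e) u w" "traversal M w ls v"
    using assms by (rule traversal_Cons)
  show ?thesis
  proof (cases ls)
    case Nil
    then have "(v, w) \<in> arcs_ends (quiver N2) ^^ 0" using w(2) by (auto simp: traversal_def)
    then show ?thesis using w(1) by blast
  next
    case (Cons l ls')
    then obtain x where x: "link_joins M l w x" using w(2) by (metis traversal_Cons)
    have "l \<noteq> Edge e" using traversal_no_backtrack assms Cons by fastforce
    then have "l \<noteq> Edge e'" for e' using edge_then_edge[OF w(1)] x by blast
    moreover have "l \<noteq> Arrow \<beta>" for \<beta> using edge_then_arrow[OF w(1)] x by blast
    ultimately obtain \<beta> where "l = Formal_Inverse \<beta>" by (cases l) auto
    then show ?thesis using w Cons traversal_from_inverse by blast
  qed
qed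

text \<open>Here \<open>x\<close> ends the initial descent and \<open>y\<close> begins the final
  ascent. They coincide unless an edge is crossed in between.\<close>

lemma traversal_shape:
  assumes "traversal M u ls v"
  shows "\<exists>k l x y. (u, x) \<in> arcs_ends (quiver N2) ^^ k \<and> (v, y) \<in> arcs_ends (quiver N2) ^^ l \<and>
    (x = y \<or> (\<exists>e. link_joins M (Edge e) x y))"
  using assms
proof (induction ls arbitrary: u)
  case Nil
  then have "(u, u) \<in> arcs_ends (quiver N2) ^^ 0" "(v, u) \<in> arcs_ends (quiver N2) ^^ 0"
    by (auto simp: traversal_def)
  then show ?case by blast
next
  case (Cons l ls)
  \<comment> \<open>The empty descent, for traversals that start with an inverse arrow or an
    edge.\<close>
  have refl: "(u, u) \<in> arcs_ends (quiver N2) ^^ 0" by simp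
  show ?case
  proof (cases l)
    case (Arrow \<alpha>)
    obtain w where w: "link_joins M (Arrow \<alpha>) u w" "traversal M w ls v"
      using Cons.prems unfolding Arrow by (rule traversal_Cons)
    obtain k l x y where IH: "(w, x) \<in> arcs_ends (quiver N2) ^^ k"
        "(v, y) \<in> arcs_ends (quiver N2) ^^ l" "x = y \<or> (\<exists>e. link_joins M (Edge e) x y)"
      using Cons.IH[OF w(2)] by blast
    have "(u, x) \<in> arcs_ends (quiver N2) ^^ Suc k"
      using arrow_arcs_ends[OF w(1)] IH(1) by (rule relpow_Suc_I2)
    then show ?thesis using IH by blast
  next
    case (Formal_Inverse \<alpha>)
    then show ?thesis using traversal_from_inverse Cons.prems refl by blast
  next
    case (Edge e)
    then show ?thesis using traversal_from_edge Cons.prems refl by blast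
  qed
qed

lemma no_sign_change:
  assumes "traversal M (n, m, i) ls (n, m, - i)" "i \<noteq> 0"
  shows False
proof -
  obtain k l x y where x: "((n, m, i), x) \<in> arcs_ends (quiver N2) ^^ k"
    and y: "((n, m, - i), y) \<in> arcs_ends (quiver N2) ^^ l"
    and xy: "x = y \<or> (\<exists>e. link_joins M (Edge e) x y)"
    using traversal_shape[OF assms(1)] by blast
  note px = covering_relpow[OF x, simplified] and py = covering_relpow[OF y, simplified]
  \<comment> \<open>Arrows keep the sign, so \<open>x = y\<close> would force
    \<open>i = - i\<close>.\<close>
  have "x \<noteq> y" using px(3) py(3) assms(2) by auto
  then obtain e where "link_joins N2 (Edge e) x y" using xy covering_link by blast
  then have fst_eq: "fst x = fst y" and snd_neq: "fst (snd x) \<noteq> fst (snd y)"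
    by (auto simp del: link_joins.simps elim!: covering_edgeD simp: siblings_def)
  have sv1: "single_valued (arcs_ends T1)" and sv2: "single_valued (arcs_ends T2)"
    using tail_inject1 tail_inject2 by (force simp: single_valued_def arcs_ends_conv)+
  \<comment> \<open>If \<open>k\<close> exceeded \<open>l\<close>, the path from \<open>n\<close>
    would be at \<open>z\<close> after \<open>l\<close> steps and again after \<open>k\<close>
    steps, giving a directed cycle in \<open>T1\<close>.\<close>
  have len: "k \<le> l"
    if nz: "(n, z) \<in> arcs_ends T1 ^^ k" "(n, z) \<in> arcs_ends T1 ^^ l" for k l z
  proof (rule ccontr)
    assume "\<not> k \<le> l"
    then obtain d where d: "k = l + d" "0 < d" by (metis less_imp_add_positive not_le)
    then obtain z' where "(n, z') \<in> arcs_ends T1 ^^ l" "(z', z) \<in> arcs_ends T1 ^^ d"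
      using nz(1) unfolding d(1) relpow_add by blast
    moreover from this(1) have "z' = z"
      using nz(2) single_valued_relpow[OF sv1] by (metis single_valuedD)
    ultimately have "(z, z) \<in> (arcs_ends T1)\<^sup>+" using d(2) by (auto simp: trancl_power)
    then show False using acyclic1 by (auto simp: acyclic_def)
  qed
  \<comment> \<open>An edge does not move the first coordinate, so both descents from
    \<open>n\<close> reach the same vertex of \<open>T1\<close>. In \<open>T2\<close> both then lead
    from \<open>m\<close> to its unique \<open>k\<close>-th ancestor, although the edge joins
    different vertices.\<close>
  have "k = l" using len px(1) py(1) fst_eq by (metis le_antisym)
  then show False
    using px(2) py(2) snd_neq single_valued_relpow[OF sv2] by (metis single_valuedD)
qed

end

section \<open>Ghosts\<close>

text \<open>The coefficient of \<open>w_m\<close> in the image of \<open>v_n\<close> is the sum of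
  the signs present over \<open>(n, m)\<close>. A single sign would leave 1 or -1, which is nonzero
  in a field.\<close>

lemma subnetwork_map_zero_imp_opposite_sign:
  fixes M1 :: "('v1, 'e1, 'w, 'a, 'k::field) rooted_tree_module"
    and M :: "('v1 \<times> 'v2 \<times> int, 'e1 \<times> 'e2 \<times> int) network"
  assumes "finite (verts (base_tree M1))" "n \<in> verts (base_tree M1)" "finite (verts (quiver M))"
    and signs: "\<And>n m j. (n, m, j) \<in> verts (quiver M) \<Longrightarrow> j \<in> {-1, 1}"
    and zero: "subnetwork_map M1 M (unit_vec n) = (\<lambda>_. 0)"
    and mem: "(n, m, j) \<in> verts (quiver M)"
  shows "(n, m, - j) \<in> verts (quiver M)"
proof (rule ccontr)
  assume opp: "(n, m, - j) \<notin> verts (quiver M)"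
  let ?S = "{(m, j). (n, m, j) \<in> verts (quiver M)}"
  have "?S = Pair n -` verts (quiver M)" by auto
  then have "finite ?S" using assms(3) by (simp add: finite_vimageI inj_on_def)
  have "(\<Sum>(m', j')\<in>?S. of_int j' * unit_vec m' m :: 'k)
      = (\<Sum>(m', j')\<in>{(m, j)}. of_int j' * unit_vec m' m)"
  proof (rule sum.mono_neutral_right[OF \<open>finite ?S\<close>])
    show "{(m, j)} \<subseteq> ?S" using mem by simp
    show "\<forall>p\<in>?S - {(m, j)}. (case p of (m', j') \<Rightarrow> of_int j' * unit_vec m' m) = (0 :: 'k)"
    proof
      fix p assume p: "p \<in> ?S - {(m, j)}"
      obtain m' j' where mj: "p = (m', j')" by (cases p)
      \<comment> \<open>Over \<open>m\<close> itself the only signs are \<open>j\<close> and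
        \<open>- j\<close>; the first is removed from the set and the second is absent by
        \<open>opp\<close>.\<close>
      have "m' \<noteq> m" using p opp signs[OF mem] signs[of n m' j'] by (auto simp: mj)
      then show "(case p of (m', j') \<Rightarrow> of_int j' * unit_vec m' m) = (0 :: 'k)"
        by (simp add: mj unit_vec_def)
    qed
  qed
  also have "\<dots> = of_int j" by (simp add: unit_vec_def)
  also have "\<dots> \<noteq> (0 :: 'k)" using signs[OF mem] by auto
  finally show False
    using fun_cong[OF zero, of m] unfolding subnetwork_map_unit_vec[OF assms(1,2)] by simp
qed

theorem lemma2p24:
  fixes Q :: "('w, 'a) pre_digraph" and rho :: "('w, 'a) path set"
    and T1 :: "('v1, 'e1) pre_digraph" and F1 :: "('v1, 'e1, 'w, 'a) quiver_map"
    and T2 :: "('v2, 'e2) pre_digraph" and F2 :: "('v2, 'e2, 'w, 'a) quiver_map"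
    and M1 :: "('v1, 'e1, 'w, 'a, 'k::field) rooted_tree_module"
    and M2 :: "('v2, 'e2, 'w, 'a, 'k) rooted_tree_module"
  assumes "CHAR('k) \<noteq> 2"
    and "bound_quiver TYPE('k) Q rho"
    and "rooted_tree_over TYPE('k) Q rho T1 F1"
    and "rooted_tree_over TYPE('k) Q rho T2 F2"
    and "M1 = tree_module T1 F1"
    and "M2 = tree_module T2 F2"
  shows "ghost_free M1 M2"
proof -
  have trees: "rooted_tree T1" "rooted_tree T2"
    and F: "quiver_morphism T1 Q F1" "quiver_morphism T2 Q F2"
    using assms(3,4) by (simp_all add: rooted_tree_over_def)
  interpret T1: fin_digraph T1 using trees by (simp add: rooted_tree_def tree_quiver_def)
  interpret T2: fin_digraph T2 using trees by (simp add: rooted_tree_def tree_quiver_def)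
  interpret pullback_pair T1 T2 Q F1 F2
  proof unfold_locales
    show "quiver_morphism T1 Q F1" "quiver_morphism T2 Q F2" by fact+
    show "acyclic (arcs_ends T1)" using trees(1) by (rule rooted_tree_acyclic)
    show "a = b" if "a \<in> arcs T1" "b \<in> arcs T1" "tail T1 a = tail T1 b" for a b
      using trees(1) that by (rule rooted_tree_tail_inject)
    show "a = b" if "a \<in> arcs T2" "b \<in> arcs T2" "tail T2 a = tail T2 b" for a b
      using trees(2) that by (rule rooted_tree_tail_inject)
  qed
  have "\<not> ghost M1 M2 M" for M
  proof
    assume "ghost M1 M2 M"
    then have sub: "subnetwork M N2" and "verts (quiver M) \<noteq> {}"
      and conn: "connected_network M"
      and free: "traversals M \<inter> covering_triangle_traversals T1 F1 T2 F2 = {}"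
      and zero: "\<And>f. f \<in> mcarrier M1 \<Longrightarrow> subnetwork_map M1 M f = (\<lambda>_. 0)"
      by (auto simp: ghost_def assms(5,6) tree_module_def Let_def)
    interpret triangle_free_subnetwork T1 T2 Q F1 F2 M
      using sub free by unfold_locales
    have verts: "verts (quiver M) \<subseteq> verts T1 \<times> verts T2 \<times> {-1, 1}"
      using sub
      by (auto simp: subnetwork_def subgraph_def covering_network_def pullback_network_def Let_def)
    obtain n m j where mem: "(n, m, j) \<in> verts (quiver M)"
      using \<open>verts (quiver M) \<noteq> {}\<close> by auto
    have base: "base_tree M1 = T1" by (simp add: assms(5) tree_module_def)
    have n: "n \<in> verts T1" using mem verts by auto
    then have "unit_vec n \<in> mcarrier M1"
      by (auto simp: assms(5) tree_module_def unit_vec_def)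
    moreover have "finite (verts (quiver M))"
      using verts by (rule finite_subset) simp
    \<comment> \<open>The map vanishes on the basis vector of \<open>n\<close>, so the opposite
      vertex also lies in \<open>M\<close>; connectedness then gives a traversal that changes the
      sign.\<close>
    ultimately have "(n, m, - j) \<in> verts (quiver M)"
      using subnetwork_map_zero_imp_opposite_sign[of M1 n M m j] n zero mem verts
      by (auto simp: base)
    then obtain ls where "traversal M (n, m, j) ls (n, m, - j)"
      using conn mem by (auto simp: connected_network_def)
    then show False using no_sign_change[of n m j ls] mem verts by auto
  qed
  then show ?thesis by (simp add: ghost_free_def)
qed

end
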